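(* For the rational difference equation $$x_{n+1} = \frac{4+x_{n}}{1+x_{n-1}}, \qquad n = 0,1,2,\ldots,$$ with initial conditions $x_{-1}, x_0 \in [0,\infty)$, the equilibrium $\bar{x} = 2$ is globally asymptotically stable.
   Context: A solution of the difference equation is a sequence $\{x_n\}_{n=-1}^{\infty}$ of elements of $[0,\infty)$ satisfying the recurrence for all $n \ge 0$; it is determined by its initial conditions $x_{-1}, x_0 \in [0,\infty)$. An equilibrium is a number $\bar{x}\in[0,\infty)$ such that the constant sequence $x_n=\bar{x}$ is a solution. An equilibrium $\bar{x}$ is locally stable if for every $\varepsilon>0$ there exists $\delta>0$ such that every solution $\{x_n\}_{n=-1}^{\infty}$ with $|x_{-1}-\bar{x}|+|x_0-\bar{x}|<\delta$ satisfies $|x_n-\bar{x}|<\varepsilon$ for all $n\ge 0$. It is a global attractor if every solution satisfies $\lim_{n\to\infty}x_n=\bar{x}$. It is globally asymptotically stable (GAS) if it is both a global attractor and locally stable. *)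

theory Defs
  imports "HOL-Analysis.Analysis"
begin

text \<open>
  Second-order difference equations \<open>x\<^sub>n\<^sub>+\<^sub>1 = F x\<^sub>n x\<^sub>n\<^sub>-\<^sub>1\<close> for \<open>n \<ge> 0\<close> on \<open>[0,\<infinity>)\<close>; the first argument
  of \<open>F\<close> is the current term, the second one the previous term.

  A sequence indexed from \<open>-1\<close> is represented by a function \<open>x\<close> on \<open>nat\<close> with the index shifted by
  one: \<open>x k\<close> stands for the term with index \<open>k - 1\<close>. Thus the initial conditions are \<open>x 0\<close> (index
  \<open>-1\<close>) and \<open>x 1\<close> (index \<open>0\<close>), and the term with index \<open>n \<ge> 0\<close> is \<open>x (Suc n)\<close>.
\<close>

definition is_solution :: "(real \<Rightarrow> real \<Rightarrow> real) \<Rightarrow> (nat \<Rightarrow> real) \<Rightarrow> bool" where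
  "is_solution F x \<longleftrightarrow>
     (\<forall>k. x k \<in> {0..}) \<and> (\<forall>n. x (Suc (Suc n)) = F (x (Suc n)) (x n))"

definition is_equilibrium :: "(real \<Rightarrow> real \<Rightarrow> real) \<Rightarrow> real \<Rightarrow> bool" where
  "is_equilibrium F c \<longleftrightarrow> c \<in> {0..} \<and> is_solution F (\<lambda>_. c)"

definition locally_stable :: "(real \<Rightarrow> real \<Rightarrow> real) \<Rightarrow> real \<Rightarrow> bool" where
  "locally_stable F c \<longleftrightarrow>
     (\<forall>\<epsilon>>0. \<exists>\<delta>>0. \<forall>x. is_solution F x \<longrightarrow> \<bar>x 0 - c\<bar> + \<bar>x 1 - c\<bar> < \<delta> \<longrightarrow>
        (\<forall>n. \<bar>x (Suc n) - c\<bar> < \<epsilon>))"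

definition global_attractor :: "(real \<Rightarrow> real \<Rightarrow> real) \<Rightarrow> real \<Rightarrow> bool" where
  "global_attractor F c \<longleftrightarrow> (\<forall>x. is_solution F x \<longrightarrow> x \<longlonglongrightarrow> c)"

definition globally_asymptotically_stable :: "(real \<Rightarrow> real \<Rightarrow> real) \<Rightarrow> real \<Rightarrow> bool" where
  "globally_asymptotically_stable F c \<longleftrightarrow> global_attractor F c \<and> locally_stable F c"

end

theory Submission
  imports Defs
begin

text \<open>
  Attraction and local stability have separate reasons.

  For attraction, every solution is bounded, so it has a finite limit inferior \<open>m\<close> and limit
  superior \<open>M\<close>. The equation in the form \<open>x\<^sub>n (1 + x\<^sub>n\<^sub>-\<^sub>2) = 4 + x\<^sub>n\<^sub>-\<^sub>1\<close>, read along a subsequence that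
  tends to \<open>M\<close> and along one that tends to \<open>m\<close>, gives \<open>M m \<le> 4\<close> and \<open>M m \<ge> 4\<close>. Thus \<open>M m = 4\<close>,
  which does not yet say that \<open>m = M\<close>: one step of the recurrence is only borderline contractive.
  But since both estimates are now equalities, whenever \<open>x\<^sub>n\<close> comes close to \<open>M\<close> the term \<open>x\<^sub>n\<^sub>-\<^sub>1\<close>
  must be close to \<open>M\<close> and \<open>x\<^sub>n\<^sub>-\<^sub>2\<close> close to \<open>m\<close>. Applied once more, to \<open>x\<^sub>n\<^sub>-\<^sub>1\<close>, the same
  observation puts \<open>x\<^sub>n\<^sub>-\<^sub>2\<close> close to \<open>M\<close>. Hence \<open>m = M = 2\<close>. Lemma \<open>predecessor_limits\<close> makes this
  exact by letting three consecutive predecessors converge along one subsequence, and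
  \<open>limit_bounds_collapse\<close> is the resulting algebra.

  For stability, put \<open>u = x\<^sub>n\<^sub>-\<^sub>1 - 2\<close> and \<open>v = x\<^sub>n - 2\<close>. The recurrence becomes
  \<open>(u, v) \<mapsto> (v, (v - 2 u) / (3 + u))\<close>, and the linearization \<open>(u, v) \<mapsto> (v, (v - 2 u) / 3)\<close> has
  complex conjugate eigenvalues, of squared modulus \<open>2/3\<close>. The quadratic form
  \<open>3 v\<^sup>2 - u v + 2 u\<^sup>2\<close>, a multiple of the one obtained from the characteristic polynomial, is
  multiplied by exactly \<open>2/3\<close> under the linearization. This leaves enough room for it to be a Lyapunov
  function of the nonlinear map near the equilibrium.
\<close>

section \<open>Solutions\<close>

abbreviation rec_map :: "real \<Rightarrow> real \<Rightarrow> real" where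
  "rec_map \<equiv> (\<lambda>u v. (4 + u) / (1 + v))"

lemma solution_nonneg: "is_solution rec_map x \<Longrightarrow> 0 \<le> x n"
  by (simp add: is_solution_def)

lemma solution_mult:
  assumes "is_solution rec_map x"
  shows "x (n + 2) * (1 + x n) = 4 + x (n + 1)"
proof -
  have "x (n + 2) = (4 + x (n + 1)) / (1 + x n)"
    using assms by (simp add: is_solution_def)
  moreover have "1 + x n \<noteq> 0"
    using solution_nonneg[OF assms, of n] by linarith
  ultimately show ?thesis
    by simp
qed

text \<open>
  One step can increase a term by at most \<open>4\<close>. Feeding this into the next step cancels the
  growth: \<open>(8 + t) / (1 + t) \<le> 8\<close> for \<open>t \<ge> 0\<close>.
\<close>
lemma solution_bounded:
  assumes sol: "is_solution rec_map x"
  shows "bounded (range x)"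
proof -
  have "x (n + 3) \<le> 8" for n
  proof -
    have nn: "0 \<le> x n" "0 \<le> x (n + 1)" "0 \<le> x (n + 2)"
      using solution_nonneg[OF sol] by auto
    have "x (n + 2) * 1 \<le> x (n + 2) * (1 + x n)"
      using nn by (intro mult_left_mono) auto
    also have "\<dots> = 4 + x (n + 1)"
      by (rule solution_mult[OF sol])
    finally have "x (n + 3) * (1 + x (n + 1)) \<le> 8 + x (n + 1)"
      using solution_mult[OF sol, of "n + 1"] by (simp add: eval_nat_numeral)
    also have "\<dots> \<le> 8 * (1 + x (n + 1))"
      using nn by simp
    finally show ?thesis
      using nn by (subst (asm) mult_le_cancel_right) auto
  qed
  then have "range (\<lambda>n. x (n + 3)) \<subseteq> {0..8}"
    using solution_nonneg[OF sol] by auto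
  then have "Bseq (\<lambda>n. x (n + 3))"
    by (rule Limits.Bseq_eq_bounded)
  then have "Bseq x"
    by (rule Bseq_offset)
  then show ?thesis
    by (simp add: Elementary_Normed_Spaces.Bseq_eq_bounded)
qed

section \<open>Global attraction\<close>

text \<open>
  Compactness of the triples of preceding terms: the three predecessors can be made to converge by
  passing to a further subsequence.
\<close>
lemma predecessor_limits:
  fixes x :: "nat \<Rightarrow> real"
  assumes bdd: "bounded (range x)" and r: "strict_mono r" and lim: "(\<lambda>k. x (r k)) \<longlonglongrightarrow> z"
  obtains s a b c where "strict_mono s"
    "(\<lambda>k. x (s k)) \<longlonglongrightarrow> c" "(\<lambda>k. x (s k + 1)) \<longlonglongrightarrow> b"
    "(\<lambda>k. x (s k + 2)) \<longlonglongrightarrow> a" "(\<lambda>k. x (s k + 3)) \<longlonglongrightarrow> z"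
proof -
  \<comment> \<open>Dropping the first three indices makes the subtraction of \<open>3\<close> on natural numbers genuine.\<close>
  define q where "q k = r (k + 3) - 3" for k
  have q3: "q k + 3 = r (k + 3)" for k
    using seq_suble[OF r, of "k + 3"] by (simp add: q_def)
  have q: "strict_mono q"
  proof (rule strict_monoI)
    fix i j :: nat assume "i < j"
    then have "r (i + 3) < r (j + 3)"
      using r by (simp add: strict_mono_def)
    then show "q i < q j"
      using q3[of i] q3[of j] by linarith
  qed
  define T where "T k = (x (q k), x (q k + 1), x (q k + 2))" for k
  have "bounded (range T)"
    by (rule bounded_subset[of "range x \<times> range x \<times> range x"])
       (auto simp: T_def intro!: bounded_Times bdd)
  then obtain l p where p: "strict_mono p" and Tp: "(T \<circ> p) \<longlonglongrightarrow> l"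
    using bounded_imp_convergent_subsequence by blast
  obtain c b a where l: "l = (c, b, a)"
    by (cases l) auto
  have "(\<lambda>k. x (q (p k))) \<longlonglongrightarrow> c" "(\<lambda>k. x (q (p k) + 1)) \<longlonglongrightarrow> b"
    "(\<lambda>k. x (q (p k) + 2)) \<longlonglongrightarrow> a"
    using tendsto_fst[OF Tp] tendsto_fst[OF tendsto_snd[OF Tp]] tendsto_snd[OF tendsto_snd[OF Tp]]
    by (auto simp: l T_def o_def)
  moreover have "(\<lambda>k. x (q (p k) + 3)) \<longlonglongrightarrow> z"
    using LIMSEQ_subseq_LIMSEQ[OF LIMSEQ_ignore_initial_segment[OF lim, of 3] p]
    by (simp add: o_def q3)
  moreover have "strict_mono (q \<circ> p)"
    using q p by (rule strict_mono_o)
  ultimately show thesis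
    using that[of "q \<circ> p" c b a] by simp
qed

lemma subsequence_limit_bounds:
  fixes x :: "nat \<Rightarrow> real"
  assumes "strict_mono s" and "(\<lambda>k. x (s k + i)) \<longlonglongrightarrow> y"
  shows "liminf (\<lambda>n. ereal (x n)) \<le> ereal y" "ereal y \<le> limsup (\<lambda>n. ereal (x n))"
proof -
  have mono: "strict_mono (\<lambda>k. s k + i)"
    using assms(1) by (simp add: strict_mono_def)
  have lim: "((\<lambda>n. ereal (x n)) \<circ> (\<lambda>k. s k + i)) \<longlonglongrightarrow> ereal y"
    using assms(2) by (simp add: o_def)
  show "liminf (\<lambda>n. ereal (x n)) \<le> ereal y"
    using liminf_subseq_mono[OF mono, of "\<lambda>n. ereal (x n)"]
      lim_imp_Liminf[OF sequentially_bot lim] by simp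
  show "ereal y \<le> limsup (\<lambda>n. ereal (x n))"
    using limsup_subseq_mono[OF mono, of "\<lambda>n. ereal (x n)"]
      lim_imp_Limsup[OF sequentially_bot lim] by simp
qed

text \<open>
  Here \<open>M, a, b, c\<close> are the limits of four consecutive terms, latest first, along a subsequence on
  which the limit superior \<open>M\<close> is attained; \<open>m, a', b'\<close> are three such limits where the limit
  inferior \<open>m\<close> is attained. Three terms at each end only give \<open>M * m = 4\<close>, with \<open>a = M\<close> and
  \<open>b = m\<close>; it is the fourth term at the upper end that forces \<open>m = M\<close>.
\<close>
lemma limit_bounds_collapse:
  fixes m M a b c a' b' :: real
  assumes m0: "0 \<le> m"
    and bounds: "a \<le> M" "m \<le> b" "b \<le> M" "m \<le> c" "m \<le> a'" "b' \<le> M"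
    and upper: "M * (1 + b) = 4 + a" "a * (1 + c) = 4 + b"
    and lower: "m * (1 + b') = 4 + a'"
  shows "m = 2" "M = 2"
proof -
  have M0: "0 \<le> M"
    using m0 bounds by linarith
  have "m * b' \<le> m * M"
    using m0 bounds by (intro mult_left_mono)
  then have ge: "4 \<le> m * M"
    using lower bounds by (simp add: algebra_simps)
  have Mmb: "M * m \<le> M * b"
    using M0 bounds by (intro mult_left_mono)
  moreover have "M + M * b = 4 + a" and "4 \<le> M * m"
    using upper(1) ge by (simp_all add: algebra_simps)
  ultimately have a: "a = M" and Mb: "M * b = M * m"
    using bounds by linarith+
  have "M \<noteq> 0"
    using ge by auto
  then have b: "b = m"
    using Mb by simp
  have "M * m \<le> M * c"
    using M0 bounds by (intro mult_left_mono)
  then have "M \<le> m"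
    using upper(2) ge by (simp add: a b algebra_simps)
  then have eq: "M = m"
    using bounds by linarith
  then have "M * M = 4"
    using upper(1) by (simp add: a b algebra_simps)
  then have "M\<^sup>2 = 2\<^sup>2"
    by (simp add: power2_eq_square)
  then show "M = 2"
    using M0 by (subst (asm) power2_eq_iff_nonneg) auto
  then show "m = 2"
    using eq by simp
qed

lemma solution_tendsto:
  assumes sol: "is_solution rec_map x"
  shows "x \<longlonglongrightarrow> 2"
proof -
  let ?X = "\<lambda>n. ereal (x n)"
  have bdd: "bounded (range x)"
    by (rule solution_bounded[OF sol])
  then obtain B where B: "\<And>n. \<bar>x n\<bar> \<le> B"
    by (auto simp: bounded_iff)
  have lo: "0 \<le> liminf ?X"
    using solution_nonneg[OF sol] by (intro Liminf_bounded) auto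
  have le: "liminf ?X \<le> limsup ?X"
    by (rule Liminf_le_Limsup) simp
  have hi: "limsup ?X \<le> ereal B"
    using B by (intro Limsup_bounded) (auto simp: abs_le_iff)
  obtain m where m: "liminf ?X = ereal m"
    using lo le hi by (cases "liminf ?X") auto
  obtain M where M: "limsup ?X = ereal M"
    using lo le hi by (cases "limsup ?X") auto
  have m0: "0 \<le> m"
    using lo m by simp
  have between: "m \<le> y" "y \<le> M" if "strict_mono s" "(\<lambda>k. x (s k + i)) \<longlonglongrightarrow> y" for s i y
    using subsequence_limit_bounds[OF that] m M by simp_all
  have recurrence: "z * (1 + b) = 4 + a"
    if "(\<lambda>k. x (s k + i)) \<longlonglongrightarrow> b" "(\<lambda>k. x (s k + (i + 1))) \<longlonglongrightarrow> a"
      "(\<lambda>k. x (s k + (i + 2))) \<longlonglongrightarrow> z" for s :: "nat \<Rightarrow> nat" and i z a b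
  proof (rule LIMSEQ_unique)
    show "(\<lambda>k. x (s k + (i + 2)) * (1 + x (s k + i))) \<longlonglongrightarrow> z * (1 + b)"
      by (intro tendsto_intros that)
    have "(\<lambda>k. 4 + x (s k + (i + 1))) \<longlonglongrightarrow> 4 + a"
      by (intro tendsto_intros that)
    then show "(\<lambda>k. x (s k + (i + 2)) * (1 + x (s k + i))) \<longlonglongrightarrow> 4 + a"
      using solution_mult[OF sol, of "s _ + i"] by (simp add: add.assoc)
  qed
  obtain r where r: "strict_mono r" and "(?X \<circ> r) \<longlonglongrightarrow> limsup ?X"
    using limsup_subseq_lim by blast
  then have "(\<lambda>k. x (r k)) \<longlonglongrightarrow> M"
    by (simp add: M o_def)
  then obtain s a b c where s: "strict_mono s"
    and upper: "(\<lambda>k. x (s k)) \<longlonglongrightarrow> c" "(\<lambda>k. x (s k + 1)) \<longlonglongrightarrow> b"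
      "(\<lambda>k. x (s k + 2)) \<longlonglongrightarrow> a" "(\<lambda>k. x (s k + 3)) \<longlonglongrightarrow> M"
    by (rule predecessor_limits[OF bdd r])
  obtain r' where r': "strict_mono r'" and "(?X \<circ> r') \<longlonglongrightarrow> liminf ?X"
    using liminf_subseq_lim by blast
  then have "(\<lambda>k. x (r' k)) \<longlonglongrightarrow> m"
    by (simp add: m o_def)
  then obtain s' a' b' c' where s': "strict_mono s'"
    and lower: "(\<lambda>k. x (s' k)) \<longlonglongrightarrow> c'" "(\<lambda>k. x (s' k + 1)) \<longlonglongrightarrow> b'"
      "(\<lambda>k. x (s' k + 2)) \<longlonglongrightarrow> a'" "(\<lambda>k. x (s' k + 3)) \<longlonglongrightarrow> m"
    by (rule predecessor_limits[OF bdd r'])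
  have c0: "(\<lambda>k. x (s k + 0)) \<longlonglongrightarrow> c"
    using upper(1) by simp
  have "a \<le> M" "m \<le> b" "b \<le> M" "m \<le> c" "m \<le> a'" "b' \<le> M"
    using between[OF s c0] between[OF s upper(2)] between[OF s upper(3)]
      between[OF s' lower(2)] between[OF s' lower(3)] by simp_all
  moreover have "M * (1 + b) = 4 + a" "a * (1 + c) = 4 + b" "m * (1 + b') = 4 + a'"
    using recurrence[of s 1 b a M] recurrence[of s 0 c b a] recurrence[of s' 1 b' a' m]
      upper lower by (simp_all add: eval_nat_numeral)
  ultimately have "m = 2" "M = 2"
    using m0 limit_bounds_collapse[of m a M b c a' b'] by blast+
  then show ?thesis
    by (intro limsup_le_liminf_real) (simp_all add: m M)
qed

section \<open>Local stability\<close>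

definition lyapunov :: "real \<Rightarrow> real \<Rightarrow> real" where
  "lyapunov u v = 3 * v\<^sup>2 - u * v + 2 * u\<^sup>2"

lemma lyapunov_lower:
  "u\<^sup>2 \<le> lyapunov u v" "v\<^sup>2 \<le> lyapunov u v"
proof -
  have "lyapunov u v - u\<^sup>2 = (u - v / 2)\<^sup>2 + 11 / 4 * v\<^sup>2"
    by (simp add: lyapunov_def power2_eq_square field_simps)
  also have "\<dots> \<ge> 0" by simp
  finally show "u\<^sup>2 \<le> lyapunov u v" by simp
  have "lyapunov u v - v\<^sup>2 = 2 * (v - u / 4)\<^sup>2 + 15 / 8 * u\<^sup>2"
    by (simp add: lyapunov_def power2_eq_square field_simps)
  also have "\<dots> \<ge> 0" by simp
  finally show "v\<^sup>2 \<le> lyapunov u v" by simp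
qed

lemma lyapunov_upper: "lyapunov u v \<le> 4 * (\<bar>u\<bar> + \<bar>v\<bar>)\<^sup>2"
proof -
  have "4 * (\<bar>u\<bar> + \<bar>v\<bar>)\<^sup>2 = 4 * u\<^sup>2 + 8 * \<bar>u * v\<bar> + 4 * v\<^sup>2"
    by (simp add: power2_sum abs_mult)
  then show ?thesis
    unfolding lyapunov_def using abs_ge_minus_self[of "u * v"] zero_le_power2[of u] zero_le_power2[of v]
    by linarith
qed

text \<open>
  With \<open>t = 3 + u\<close>, the decrease multiplied by \<open>t\<^sup>2\<close> is a quadratic form in \<open>(u, v)\<close> whose
  coefficients depend on \<open>t\<close> only. It is positive definite at \<open>t = 3\<close>, hence also for \<open>t\<close> near \<open>3\<close>.
\<close>
lemma lyapunov_decreasing: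
  fixes u v :: real
  assumes u: "\<bar>u\<bar> \<le> 1/4"
  shows "lyapunov v ((v - 2 * u) / (3 + u)) \<le> lyapunov u v"
proof -
  define t where "t = 3 + u"
  have t: "11/4 \<le> t" "t \<le> 13/4"
    using u by (auto simp: t_def)
  define w where "w = (v - 2 * u) / t"
  have wt: "w * t = v - 2 * u"
    using t by (simp add: w_def)
  have t2: "(11/4)\<^sup>2 \<le> t\<^sup>2" "t\<^sup>2 \<le> (13/4)\<^sup>2"
    using t by (intro power_mono; simp)+
  have A: "3 \<le> 2 * t\<^sup>2 - 12" and C: "3 \<le> t\<^sup>2 + t - 3" and D: "\<bar>12 - 2 * t - t\<^sup>2\<bar> \<le> 6"
    using t t2 by (simp_all add: power2_eq_square abs_le_iff)
  have "t\<^sup>2 * (lyapunov u v - lyapunov v w)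
      = t\<^sup>2 * (3 * v\<^sup>2 - u * v + 2 * u\<^sup>2) - 3 * (w * t)\<^sup>2 + v * t * (w * t) - 2 * v\<^sup>2 * t\<^sup>2"
    by (simp add: lyapunov_def power2_eq_square algebra_simps)
  also have "\<dots> = (2 * t\<^sup>2 - 12) * u\<^sup>2 + (12 - 2 * t - t\<^sup>2) * (u * v) + (t\<^sup>2 + t - 3) * v\<^sup>2"
    unfolding wt by (simp add: power2_eq_square algebra_simps)
  also have "\<dots> \<ge> 3 * u\<^sup>2 - 6 * \<bar>u * v\<bar> + 3 * v\<^sup>2"
  proof -
    have "3 * u\<^sup>2 \<le> (2 * t\<^sup>2 - 12) * u\<^sup>2" "3 * v\<^sup>2 \<le> (t\<^sup>2 + t - 3) * v\<^sup>2"
      using A C by (intro mult_right_mono; simp)+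
    moreover have "\<bar>(12 - 2 * t - t\<^sup>2) * (u * v)\<bar> \<le> 6 * \<bar>u * v\<bar>"
      unfolding abs_mult[of _ "u * v"] using D by (intro mult_right_mono) auto
    ultimately show ?thesis
      by linarith
  qed
  also have "3 * u\<^sup>2 - 6 * \<bar>u * v\<bar> + 3 * v\<^sup>2 = 3 * (\<bar>u\<bar> - \<bar>v\<bar>)\<^sup>2"
    by (simp add: power2_diff abs_mult)
  finally have "0 \<le> t\<^sup>2 * (lyapunov u v - lyapunov v w)"
    by (smt (verit) zero_le_power2)
  moreover have "0 < t\<^sup>2"
    using t by simp
  ultimately have "lyapunov v w \<le> lyapunov u v"
    by (simp add: zero_le_mult_iff)
  then show ?thesis
    by (simp add: w_def t_def)
qed

lemma equilibrium_locally_stable: "locally_stable rec_map 2"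
  unfolding locally_stable_def
proof (intro allI impI)
  fix \<epsilon> :: real assume "\<epsilon> > 0"
  \<comment> \<open>The sublevel set of height \<open>e\<^sup>2\<close> lies in the square of side length \<open>2 e\<close>, on which the
    form is decreasing as soon as \<open>e \<le> 1/4\<close>.\<close>
  define e where "e = min \<epsilon> (1/4)"
  have e: "0 < e" "e \<le> \<epsilon>" "e \<le> 1/4"
    using \<open>\<epsilon> > 0\<close> by (auto simp: e_def)
  show "\<exists>\<delta>>0. \<forall>x. is_solution rec_map x \<longrightarrow> \<bar>x 0 - 2\<bar> + \<bar>x 1 - 2\<bar> < \<delta> \<longrightarrow>
      (\<forall>n. \<bar>x (Suc n) - 2\<bar> < \<epsilon>)"
  proof (intro exI[of _ "e / 2"] conjI allI impI)
    show "0 < e / 2"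
      using e by simp
  next
    fix x n
    assume sol: "is_solution rec_map x" and init: "\<bar>x 0 - 2\<bar> + \<bar>x 1 - 2\<bar> < e / 2"
    let ?L = "\<lambda>n. lyapunov (x n - 2) (x (n + 1) - 2)"
    have close: "\<bar>x n - 2\<bar> < e" "\<bar>x (n + 1) - 2\<bar> < e" if "?L n < e\<^sup>2" for n
    proof -
      have "\<bar>x n - 2\<bar>\<^sup>2 < e\<^sup>2" "\<bar>x (n + 1) - 2\<bar>\<^sup>2 < e\<^sup>2"
        unfolding power2_abs
        using that lyapunov_lower[where u = "x n - 2" and v = "x (n + 1) - 2"] by linarith+
      then show "\<bar>x n - 2\<bar> < e" "\<bar>x (n + 1) - 2\<bar> < e"
        using e(1) by (auto intro: power2_less_imp_less)
    qed
    have "?L n < e\<^sup>2" for n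
    proof (induction n)
      case 0
      have "?L 0 \<le> 4 * (\<bar>x 0 - 2\<bar> + \<bar>x 1 - 2\<bar>)\<^sup>2"
        using lyapunov_upper by simp
      also have "\<dots> < 4 * (e / 2)\<^sup>2"
        using init by (intro mult_strict_left_mono power_strict_mono) auto
      finally show ?case
        by (simp add: power_divide)
    next
      case (Suc n)
      have "1 + x n \<noteq> 0"
        using solution_nonneg[OF sol, of n] by linarith
      then have "x (n + 2) - 2 = ((x (n + 1) - 2) - 2 * (x n - 2)) / (3 + (x n - 2))"
        using solution_mult[OF sol, of n] by (simp add: field_simps)
      moreover have "\<bar>x n - 2\<bar> \<le> 1/4"
        using close(1)[OF Suc] e by linarith
      ultimately have "?L (Suc n) \<le> ?L n"
        using lyapunov_decreasing[of "x n - 2" "x (n + 1) - 2"] by simp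
      then show ?case
        using Suc by linarith
    qed
    from close(2)[OF this[of n]] show "\<bar>x (Suc n) - 2\<bar> < \<epsilon>"
      using e by simp
  qed
qed

theorem theorem4p1:
  shows "is_equilibrium (\<lambda>u v. (4 + u) / (1 + v)) 2 \<and>
    globally_asymptotically_stable (\<lambda>u v. (4 + u) / (1 + v)) 2"
proof
  show "is_equilibrium rec_map 2"
    by (simp add: is_equilibrium_def is_solution_def)
  show "globally_asymptotically_stable rec_map 2"
    using solution_tendsto equilibrium_locally_stable
    by (simp add: globally_asymptotically_stable_def global_attractor_def)
qed

end
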